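(* For every $x\in(0,1/2)$, the degree distribution of the Haros graph $G_x$ satisfies $$P(2,x)=x,\qquad P(3,x)=1-2x,\qquad P(4,x)=0.$$
   Context: Farey binary tree: level $\ell_1=\{0/1,1/1\}$, and $\ell_{n+1}$ consists of the mediants $\frac{p+p'}{q+q'}$ of all pairs $p/q<p'/q'$ that are adjacent (in increasing order) in $\bigcup_{i\le n}\ell_i$. Every reduced fraction $p/q\in[0,1]$ occurs exactly once. Every $p/q\in(0,1)$ is the mediant of a unique such adjacent pair $p_1/q_1<p_2/q_2$ (its left and right parents, $p=p_1+p_2$, $q=q_1+q_2$). Symbolic path: by convention paths start at $1/1$ and the step $1/1\to1/2$ is $L$; a node at level $n\ge2$ has two children at level $n+1$, $L$ leading to the smaller and $R$ to the larger. If $x=[a_1,a_2,\dots]$ (i.e. $x=1/(a_1+1/(a_2+\cdots))$), the path of $x$ is $L^{a_1}R^{a_2}L^{a_3}\cdots$, where for rational $x=[a_1,\dots,a_m]$ ($a_m\ge2$) the last exponent is $a_m-1$; irrational $x$ have infinite paths. Haros graphs: graphs with linearly ordered nodes. $G_0$ has two nodes joined by an edge. For $G$ with nodes $v_1,\dots,v_a$ and $G'$ with nodes $w_1,\dots,w_b$, the concatenation $G\oplus G'$ has nodes $u_1,\dots,u_{a+b-1}$, obtained by identifying $v_a$ with $w_1$ (the merging node $u_a$), $u_i=v_i$ for $i\le a$, $u_{a-1+j}=w_j$, keeping all edges of $G$ and $G'$, and adding one new edge $u_1u_{a+b-1}$. Set $G_{0/1}=G_{1/1}=G_0$ and, for reduced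 $p/q\in(0,1)$ with left/right parents $p_1/q_1<p_2/q_2$, $G_{p/q}=G_{p_1/q_1}\oplus G_{p_2/q_2}$; it has $q+1$ nodes. Degree convention: the first and last nodes are identified into a single boundary node whose degree is the sum of their degrees (other nodes are inner), giving $q$ nodes; $P(k,p/q)$ is the fraction of these $q$ nodes with degree $k$. For irrational $x$, $P(k,x)=\lim_{j\to\infty}P(k,x_j)$, where $x_j$ are the successive rationals visited by the symbolic path of $x$. *)

theory Defs
  imports Complex_Main
begin

section \<open>The Farey binary tree\<close>

abbreviation num :: "rat \<Rightarrow> int" where "num r \<equiv> fst (quotient_of r)"
abbreviation den :: "rat \<Rightarrow> int" where "den r \<equiv> snd (quotient_of r)"

definition mediant :: "rat \<Rightarrow> rat \<Rightarrow> rat" where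
  "mediant a b = Fract (num a + num b) (den a + den b)"

definition adjacent_in :: "rat set \<Rightarrow> rat \<Rightarrow> rat \<Rightarrow> bool" where
  "adjacent_in S a b \<longleftrightarrow> a \<in> S \<and> b \<in> S \<and> a < b \<and> (\<forall>c\<in>S. \<not> (a < c \<and> c < b))"

text \<open>Levels are numbered from 1; level 0 is empty.\<close>

fun farey_level :: "nat \<Rightarrow> rat set" where
  "farey_level 0 = {}"
| "farey_level (Suc 0) = {0, 1}"
| "farey_level (Suc (Suc n)) =
     {mediant a b | a b. adjacent_in (\<Union>i\<in>{1..Suc n}. farey_level i) a b}"

definition farey_upto :: "nat \<Rightarrow> rat set" where
  "farey_upto n = (\<Union>i\<in>{1..n}. farey_level i)"

definition is_parents :: "rat \<Rightarrow> rat \<Rightarrow> rat \<Rightarrow> bool" where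
  "is_parents r a b \<longleftrightarrow> (\<exists>n\<ge>1. adjacent_in (farey_upto n) a b \<and> r = mediant a b)"

definition left_parent :: "rat \<Rightarrow> rat" where
  "left_parent r = (THE a. \<exists>b. is_parents r a b)"

definition right_parent :: "rat \<Rightarrow> rat" where
  "right_parent r = (THE b. \<exists>a. is_parents r a b)"

definition children :: "rat \<Rightarrow> rat set" where
  "children r = {s. \<exists>n\<ge>1. r \<in> farey_level n \<and> s \<in> farey_level (Suc n) \<and>
                        (r = left_parent s \<or> r = right_parent s)}"

subsection \<open>Existence and uniqueness of the parents\<close>

definition unimod :: "rat \<Rightarrow> rat \<Rightarrow> bool" where
  "unimod a b \<longleftrightarrow> num b * den a - num a * den b = 1"

lemma den_pos [simp]: "den r > 0"
  by (rule quotient_of_denom_pos')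

lemma rat_less_iff: "a < b \<longleftrightarrow> num a * den b < num b * den a"
proof -
  have "a < b \<longleftrightarrow> Fract (num a) (den a) < Fract (num b) (den b)" by simp
  also have "\<dots> \<longleftrightarrow> num a * den b < num b * den a"
    using den_pos[of a] den_pos[of b] by (simp del: Fract_quotient_of den_pos)
  finally show ?thesis .
qed

lemma quotient_mediant:
  assumes "unimod a b"
  shows "quotient_of (mediant a b) = (num a + num b, den a + den b)"
proof -
  have pos: "den a + den b > 0" using den_pos[of a] den_pos[of b] by linarith
  have "coprime (num a + num b) (den a + den b)"
  proof (rule coprimeI)
    fix c assume c: "c dvd num a + num b" "c dvd den a + den b"
    have "(num a + num b) * den a - num a * (den a + den b) = 1"
      using assms by (simp add: unimod_def algebra_simps)
    moreover have "c dvd (num a + num b) * den a - num a * (den a + den b)"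
      using c by (intro dvd_diff dvd_mult2 dvd_mult)
    ultimately show "is_unit c" by simp
  qed
  then show ?thesis using pos
    by (simp add: mediant_def quotient_of_Fract Rat.normalize_def)
qed

lemma unimod_mediant:
  assumes "unimod a b"
  shows "unimod a (mediant a b)" "unimod (mediant a b) b"
  using assms quotient_mediant[OF assms] by (simp_all add: unimod_def algebra_simps)

lemma unimod_less: "unimod a b \<Longrightarrow> a < b"
  by (simp add: unimod_def rat_less_iff)

lemma mediant_between:
  assumes "unimod a b"
  shows "a < mediant a b" "mediant a b < b"
  using unimod_mediant[OF assms] by (simp_all add: unimod_less)

lemma farey_upto_1: "farey_upto (Suc 0) = {0, 1}"
  by (simp add: farey_upto_def)

lemma farey_level_Suc:
  "n \<ge> 1 \<Longrightarrow> farey_level (Suc n) = {mediant a b | a b. adjacent_in (farey_upto n) a b}"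
  by (cases n) (simp_all add: farey_upto_def)

lemma farey_upto_Suc: "farey_upto (Suc n) = farey_upto n \<union> farey_level (Suc n)"
  by (auto simp: farey_upto_def atLeastAtMostSuc_conv)

lemma adjacent_order:
  assumes "adjacent_in S a b" "adjacent_in S c d" "(a, b) \<noteq> (c, d)"
  shows "b \<le> c \<or> d \<le> a"
  using assms unfolding adjacent_in_def by (metis linorder_neqE not_le)

lemma farey_adjacent_unimod:
  assumes "n \<ge> 1" "adjacent_in (farey_upto n) a b"
  shows "unimod a b"
  using assms
proof (induction n arbitrary: a b rule: nat_induct_at_least)
  case base
  then show ?case by (auto simp: farey_upto_1 adjacent_in_def unimod_def)
next
  case (Suc n c d)
  note lev = farey_level_Suc[OF Suc.hyps] and IH = Suc.IH
  have cd: "c \<in> farey_upto (Suc n)" "d \<in> farey_upto (Suc n)" "c < d"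
    and no: "\<And>e. e \<in> farey_upto (Suc n) \<Longrightarrow> c < e \<Longrightarrow> e < d \<Longrightarrow> False"
    using Suc.prems by (auto simp: adjacent_in_def)
  have old: "e \<in> farey_upto (Suc n)" if "e \<in> farey_upto n" for e
    using that by (simp add: farey_upto_Suc)
  consider (oo) "c \<in> farey_upto n" "d \<in> farey_upto n"
    | (on) a b where "c \<in> farey_upto n" "d = mediant a b" "adjacent_in (farey_upto n) a b"
    | (no) a b where "d \<in> farey_upto n" "c = mediant a b" "adjacent_in (farey_upto n) a b"
    | (nn) a b a' b' where "c = mediant a b" "adjacent_in (farey_upto n) a b"
        "d = mediant a' b'" "adjacent_in (farey_upto n) a' b'"
    using cd by (auto simp: farey_upto_Suc lev)
  then show ?case
  proof cases
    case oo
    then have adj: "adjacent_in (farey_upto n) c d"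
      using cd(3) no old by (auto simp: adjacent_in_def)
    then have "mediant c d \<in> farey_upto (Suc n)" by (auto simp: farey_upto_Suc lev)
    then show ?thesis using no mediant_between[OF IH[OF adj]] by blast
  next
    case on
    note u = IH[OF on(3)]
    have "a \<le> c" using no[of a] on mediant_between[OF u] old
      by (force simp: adjacent_in_def)
    moreover have "c < b" using cd(3) mediant_between[OF u] on by simp
    ultimately have "c = a" using on by (auto simp: adjacent_in_def)
    then show ?thesis using unimod_mediant[OF u] on by simp
  next
    case no
    note u = IH[OF no(3)]
    have "d \<le> b" using \<open>\<And>e. e \<in> farey_upto (Suc n) \<Longrightarrow> c < e \<Longrightarrow> e < d \<Longrightarrow> False\<close>[of b]
        no mediant_between[OF u] old by (force simp: adjacent_in_def)
    moreover have "a < d" using cd(3) mediant_between[OF u] no by simp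
    ultimately have "d = b" using no by (auto simp: adjacent_in_def)
    then show ?thesis using unimod_mediant[OF u] no by simp
  next
    case nn
    note u = mediant_between[OF IH[OF nn(2)]] mediant_between[OF IH[OF nn(4)]]
    have "(a, b) \<noteq> (a', b')" using nn cd(3) by auto
    then have "b \<le> a' \<or> b' \<le> a" using adjacent_order nn by blast
    moreover have "\<not> b' \<le> a" using u nn cd(3) by auto
    ultimately have "b \<le> a'" by simp
    then have "c < b" "b < d" using u nn by auto
    then show ?thesis using no[of b] old nn by (auto simp: adjacent_in_def)
  qed
qed

lemma farey_adjacent_Suc:
  assumes n: "n \<ge> 1" and adj: "adjacent_in (farey_upto n) a b"
  shows "adjacent_in (farey_upto (Suc n)) a (mediant a b)"
    and "adjacent_in (farey_upto (Suc n)) (mediant a b) b"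
proof -
  note u = mediant_between[OF farey_adjacent_unimod[OF n]]
  have only: "e = mediant a b" if e: "e \<in> farey_upto (Suc n)" "a < e" "e < b" for e
  proof -
    have "e \<notin> farey_upto n" using e adj by (auto simp: adjacent_in_def)
    then obtain c d where cd: "adjacent_in (farey_upto n) c d" "e = mediant c d"
      using e by (auto simp: farey_upto_Suc farey_level_Suc[OF n])
    have "(a, b) = (c, d)"
    proof (rule ccontr)
      assume "(a, b) \<noteq> (c, d)"
      then have "b \<le> c \<or> d \<le> a" using adjacent_order adj cd by blast
      then show False using u[OF cd(1)] cd e by auto
    qed
    then show ?thesis using cd by simp
  qed
  have "mediant a b \<in> farey_upto (Suc n)" "a \<in> farey_upto (Suc n)" "b \<in> farey_upto (Suc n)"
    using adj by (auto simp: farey_upto_Suc farey_level_Suc[OF n] adjacent_in_def)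
  then show "adjacent_in (farey_upto (Suc n)) a (mediant a b)"
    and "adjacent_in (farey_upto (Suc n)) (mediant a b) b"
    using u[OF adj] only unfolding adjacent_in_def by (metis less_trans less_irrefl)+
qed

lemma den_sum_le:
  assumes u: "unimod a b" and "a < r" "r < b"
  shows "den a + den b \<le> den r"
proof -
  have 1: "num r * den a - num a * den r \<ge> 1" using assms(2) by (simp add: rat_less_iff)
  have 2: "num b * den r - num r * den b \<ge> 1" using assms(3) by (simp add: rat_less_iff)
  have "den r = den r * (num b * den a - num a * den b)"
    using u by (simp add: unimod_def)
  also have "\<dots> = (num r * den a - num a * den r) * den b + (num b * den r - num r * den b) * den a"
    by (simp add: algebra_simps)
  finally show ?thesis
    using mult_right_mono[OF 1, of "den b"] mult_right_mono[OF 2, of "den a"]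
      den_pos[of a] den_pos[of b] by linarith
qed

lemma farey_locate:
  assumes "n \<ge> 1" "0 < r" "r < 1"
  shows "r \<in> farey_upto n \<or>
    (\<exists>a b. adjacent_in (farey_upto n) a b \<and> a < r \<and> r < b \<and> den a + den b > int n)"
  using assms
proof (induction n rule: nat_induct_at_least)
  case base
  then show ?case
    by (intro disjI2 exI[of _ 0] exI[of _ 1]) (auto simp: farey_upto_1 adjacent_in_def)
next
  case (Suc n)
  then consider "r \<in> farey_upto n"
    | a b where "adjacent_in (farey_upto n) a b" "a < r" "r < b" "den a + den b > int n"
    by blast
  then show ?case
  proof cases
    case 1
    then show ?thesis by (simp add: farey_upto_Suc)
  next
    case 2
    note adj = farey_adjacent_Suc[OF Suc.hyps 2(1)]
    have den: "den (mediant a b) = den a + den b"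
      using quotient_mediant[OF farey_adjacent_unimod[OF Suc.hyps 2(1)]] by simp
    consider "r = mediant a b" | "r < mediant a b" | "mediant a b < r" by linarith
    then show ?thesis
    proof cases
      case 1
      then show ?thesis using adj by (auto simp: adjacent_in_def)
    next
      case c: 2
      have "den a + den (mediant a b) > int (Suc n)" using den 2(4) den_pos[of a] by linarith
      then show ?thesis using adj(1) 2 c by blast
    next
      case c: 3
      have "den (mediant a b) + den b > int (Suc n)" using den 2(4) den_pos[of b] by linarith
      then show ?thesis using adj(2) 2 c by blast
    qed
  qed
qed

lemma farey_complete:
  assumes "0 < r" "r < 1"
  shows "\<exists>n. r \<in> farey_upto n"
proof -
  define n where "n = nat (den r)"
  have n: "n \<ge> 1" "int n = den r" using den_pos[of r] unfolding n_def by linarith+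
  from farey_locate[OF n(1) assms] show ?thesis
  proof
    assume "\<exists>a b. adjacent_in (farey_upto n) a b \<and> a < r \<and> r < b \<and> den a + den b > int n"
    then obtain a b where ab: "adjacent_in (farey_upto n) a b" "a < r" "r < b"
      "den a + den b > int n" by blast
    then have "den a + den b \<le> den r"
      using den_sum_le farey_adjacent_unimod[OF n(1)] by blast
    then show ?thesis using ab n by simp
  qed blast
qed

lemma is_parents_ex:
  assumes "0 < r" "r < 1"
  shows "\<exists>a b. is_parents r a b"
proof -
  obtain n i where i: "r \<in> farey_level i" using farey_complete[OF assms]
    by (auto simp: farey_upto_def)
  have "i \<noteq> 0" "i \<noteq> Suc 0" using i assms by (auto intro: ccontr)
  then obtain m where m: "i = Suc m" "m \<ge> 1" by (cases i) auto
  then show ?thesis using i farey_level_Suc[of m] by (auto simp: is_parents_def)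
qed

lemma is_parents_unimod: "is_parents r a b \<Longrightarrow> unimod a b"
  by (auto simp: is_parents_def intro: farey_adjacent_unimod)

lemma is_parents_sum:
  assumes "is_parents r a b"
  shows "num r = num a + num b" "den r = den a + den b"
  using quotient_mediant[OF is_parents_unimod[OF assms]] assms by (auto simp: is_parents_def)

lemma is_parents_unique:
  assumes "is_parents r a b" "is_parents r c d"
  shows "a = c \<and> b = d"
proof -
  note s = is_parents_sum[OF assms(1)] is_parents_sum[OF assms(2)]
  have 1: "num r * den a - num a * den r = 1"
    using is_parents_unimod[OF assms(1)] s(1,2) by (simp add: unimod_def algebra_simps)
  have 2: "num r * den c - num c * den r = 1"
    using is_parents_unimod[OF assms(2)] s(3,4) by (simp add: unimod_def algebra_simps)
  have eq: "num r * (den a - den c) = den r * (num a - num c)"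
    using 1 2 by (simp add: algebra_simps)
  have "coprime (den r) (num r)"
    using quotient_of_coprime[of r "num r" "den r"] by (simp add: coprime_commute)
  moreover have "den r dvd num r * (den a - den c)" using eq by simp
  ultimately have "den r dvd den a - den c" by (simp add: coprime_dvd_mult_right_iff)
  moreover have "\<bar>den a - den c\<bar> < den r"
    using s den_pos[of a] den_pos[of b] den_pos[of c] den_pos[of d] by linarith
  ultimately have d: "den a = den c" using dvd_imp_le_int[of "den a - den c" "den r"] by fastforce
  then have "num a = num c" using eq den_pos[of r] by simp
  then have "a = c" using d quotient_of_inject_eq[of a c] by (simp add: prod_eq_iff)
  moreover have "b = d" using s d \<open>num a = num c\<close> quotient_of_inject_eq[of b d]
    by (simp add: prod_eq_iff)
  ultimately show ?thesis ..
qed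

lemma parents_eqI:
  assumes "is_parents r a b"
  shows "left_parent r = a" "right_parent r = b"
  unfolding left_parent_def right_parent_def
  using assms is_parents_unique by blast+

lemma is_parents_parents:
  assumes "0 < r" "r < 1"
  shows "is_parents r (left_parent r) (right_parent r)"
  using is_parents_ex[OF assms] parents_eqI by metis

lemma den_parents_less:
  assumes "0 < r" "r < 1"
  shows "den (left_parent r) < den r" "den (right_parent r) < den r"
  using is_parents_sum[OF is_parents_parents[OF assms]]
    den_pos[of "left_parent r"] den_pos[of "right_parent r"] by linarith+

lemma farey_level_between:
  assumes "n \<ge> 2" "r \<in> farey_level n"
  shows "0 < r" "r < 1"
proof -
  have rng: "farey_upto m \<subseteq> {0..1}" if "m \<ge> 1" for m
    using that
  proof (induction m rule: nat_induct_at_least)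
    case base then show ?case by (simp add: farey_upto_1)
  next
    case (Suc m)
    have "0 \<le> e \<and> e \<le> 1" if ab: "e = mediant a b" "adjacent_in (farey_upto m) a b" for e a b
    proof -
      have "0 \<le> a" "b \<le> 1" using ab Suc.IH by (auto simp: adjacent_in_def)
      then show ?thesis using mediant_between[OF farey_adjacent_unimod[OF Suc.hyps ab(2)]] ab
        by auto
    qed
    then show ?case using Suc by (auto simp: farey_upto_Suc farey_level_Suc)
  qed
  obtain m where m: "n = Suc m" "m \<ge> 1" using assms(1) by (cases n) auto
  then obtain a b where ab: "r = mediant a b" "adjacent_in (farey_upto m) a b"
    using assms farey_level_Suc by auto
  have "0 \<le> a" "b \<le> 1" using ab rng[OF m(2)] by (auto simp: adjacent_in_def)
  then show "0 < r" "r < 1"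
    using mediant_between[OF farey_adjacent_unimod[OF m(2) ab(2)]] ab by auto
qed

lemma children_eq:
  assumes "0 < r" "r < 1"
  shows "children r = {mediant (left_parent r) r, mediant r (right_parent r)}"
proof -
  let ?a = "left_parent r" and ?b = "right_parent r"
  have adj: "adjacent_in (farey_upto n) ?a r \<and> adjacent_in (farey_upto n) r ?b \<and> n \<ge> 1"
    if n: "r \<in> farey_level n" "n \<ge> 1" for n
  proof -
    have "n \<noteq> Suc 0" using n assms by auto
    then obtain m where m: "n = Suc m" "m \<ge> 1" using n by (cases n) auto
    then obtain a b where ab: "r = mediant a b" "adjacent_in (farey_upto m) a b"
      using n farey_level_Suc by auto
    then have "is_parents r a b" using m by (auto simp: is_parents_def)
    then show ?thesis using parents_eqI farey_adjacent_Suc[OF m(2) ab(2)] ab m by simp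
  qed
  obtain n where n: "n \<ge> 1" "r \<in> farey_level n" using farey_complete[OF assms]
    by (auto simp: farey_upto_def)
  have "s = mediant ?a r \<or> s = mediant r ?b" if s: "s \<in> children r" for s
  proof -
    obtain k where k: "k \<ge> 1" "r \<in> farey_level k" "s \<in> farey_level (Suc k)"
      "r = left_parent s \<or> r = right_parent s" using s by (auto simp: children_def)
    obtain c d where cd: "s = mediant c d" "adjacent_in (farey_upto k) c d"
      using k farey_level_Suc by auto
    have "is_parents s c d" using cd k by (auto simp: is_parents_def)
    then have "left_parent s = c" "right_parent s = d" by (simp_all add: parents_eqI)
    with k(4) consider "r = c" | "r = d" by auto
    then show ?thesis
    proof cases
      case 1
      then have "d = ?b" using adj[OF k(2,1)] cd(2) unfolding adjacent_in_def
        by (metis linorder_neqE)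
      then show ?thesis using 1 cd by simp
    next
      case 2
      then have "c = ?a" using adj[OF k(2,1)] cd(2) unfolding adjacent_in_def
        by (metis linorder_neqE)
      then show ?thesis using 2 cd by simp
    qed
  qed
  moreover have "mediant ?a r \<in> children r"
  proof -
    have "is_parents (mediant ?a r) ?a r" using adj[OF n(2,1)] by (auto simp: is_parents_def)
    then have "right_parent (mediant ?a r) = r" by (rule parents_eqI)
    then show ?thesis using n adj[OF n(2,1)] farey_level_Suc[OF n(1)]
      by (auto simp: children_def intro!: exI[of _ n])
  qed
  moreover have "mediant r ?b \<in> children r"
  proof -
    have "is_parents (mediant r ?b) r ?b" using adj[OF n(2,1)] by (auto simp: is_parents_def)
    then have "left_parent (mediant r ?b) = r" by (rule parents_eqI)
    then show ?thesis using n adj[OF n(2,1)] farey_level_Suc[OF n(1)]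
      by (auto simp: children_def intro!: exI[of _ n])
  qed
  ultimately show ?thesis by blast
qed

lemma adjacent_01: "adjacent_in {0, 1} a b \<longleftrightarrow> a = 0 \<and> b = 1"
  by (auto simp: adjacent_in_def)

lemma mediant_0_1: "mediant 0 1 = 1 / 2"
  by (simp add: mediant_def Fract_of_int_quotient)

lemma children_1: "children 1 = {1 / 2}"
proof -
  have lev: "1 \<in> farey_level n \<longleftrightarrow> n = 1" for n
    using farey_level_between(2)[of n 1] by (cases n rule: farey_level.cases) auto
  have l2: "farey_level (Suc (Suc 0)) = {1 / 2}"
    using farey_level_Suc[of 1] by (auto simp: farey_upto_1 adjacent_01 mediant_0_1)
  have "is_parents (1 / 2) 0 1"
    unfolding is_parents_def
    by (rule exI[of _ 1]) (simp add: farey_upto_1 adjacent_01 mediant_0_1)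
  then have "right_parent (1 / 2) = 1" by (rule parents_eqI)
  then show ?thesis using l2 by (auto simp: children_def lev)
qed

section \<open>Haros graphs\<close>

text \<open>A graph on the linearly ordered nodes \<open>1, \<dots>, num_nodes G\<close>;
  an edge is the set of its two endpoints.\<close>

datatype ograph = OGraph (num_nodes: nat) (edges: "nat set set")

definition G0 :: ograph where
  "G0 = OGraph 2 {{1, 2}}"

definition concat_graph :: "ograph \<Rightarrow> ograph \<Rightarrow> ograph" (infixl "\<oplus>\<^sub>G" 65) where
  "G \<oplus>\<^sub>G H = OGraph (num_nodes G + num_nodes H - 1)
     (edges G \<union> (\<lambda>e. (\<lambda>j. num_nodes G - 1 + j) ` e) ` edges H \<union>
      {{1, num_nodes G + num_nodes H - 1}})"

text \<open>Only arguments in \<open>[0, 1]\<close> are meaningful.\<close>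

function haros_graph :: "rat \<Rightarrow> ograph" where
  "haros_graph r =
     (if 0 < r \<and> r < 1 then haros_graph (left_parent r) \<oplus>\<^sub>G haros_graph (right_parent r) else G0)"
  by pat_completeness auto
termination
  by (relation "measure (\<lambda>r. nat (den r))") (auto simp: den_parents_less)

declare haros_graph.simps [simp del]

lemma num_nodes_haros_graph:
  assumes "0 \<le> r" "r \<le> 1"
  shows "num_nodes (haros_graph r) = nat (den r) + 1"
  using assms
proof (induction r rule: haros_graph.induct)
  case (1 r)
  show ?case
  proof (cases "0 < r \<and> r < 1")
    case True
    obtain n where n: "n \<ge> 1" "adjacent_in (farey_upto n) (left_parent r) (right_parent r)"
      using is_parents_parents True by (auto simp: is_parents_def)
    have mem: "0 \<le> e \<and> e \<le> 1" if e: "e \<in> farey_upto n" for e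
    proof -
      obtain i where "i \<ge> 1" "e \<in> farey_level i" using e unfolding farey_upto_def by auto
      then show ?thesis using farey_level_between[of i e] by (cases "i = 1") auto
    qed
    have "num_nodes (haros_graph (left_parent r)) = nat (den (left_parent r)) + 1"
      "num_nodes (haros_graph (right_parent r)) = nat (den (right_parent r)) + 1"
      using 1 True n mem by (auto simp: adjacent_in_def)
    then show ?thesis
      using True is_parents_sum(2)[OF is_parents_parents[of r]]
        den_pos[of "left_parent r"] den_pos[of "right_parent r"]
      by (simp add: haros_graph.simps[of r] concat_graph_def nat_add_distrib less_imp_le)
  next
    case False
    then have "r = 0 \<or> r = 1" using "1.prems" by auto
    then show ?thesis by (auto simp: haros_graph.simps[of r] G0_def)
  qed
qed

definition node_degree :: "ograph \<Rightarrow> nat \<Rightarrow> nat" where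
  "node_degree G v = card {e \<in> edges G. v \<in> e}"

text \<open>After the first and the last node have been identified, node 1 stands for the
  boundary node, so that the remaining nodes are \<open>1, \<dots>, num_nodes G - 1\<close>.\<close>

definition merged_degree :: "ograph \<Rightarrow> nat \<Rightarrow> nat" where
  "merged_degree G v =
     (if v = 1 then node_degree G 1 + node_degree G (num_nodes G) else node_degree G v)"

definition degree_fraction :: "nat \<Rightarrow> ograph \<Rightarrow> real" where
  "degree_fraction k G =
     real (card {v \<in> {1..<num_nodes G}. merged_degree G v = k}) / real (num_nodes G - 1)"

section \<open>Symbolic paths and the degree distribution\<close>

text \<open>For irrational \<open>x\<close> in \<open>(0, 1)\<close>: the remainders of the continued fraction expansion
  \<open>x = 1 / (a\<^sub>1 + 1 / (a\<^sub>2 + \<dots>))\<close> (iterates of the Gauss map) and the partial quotients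
  \<open>cf_digit x i\<close>, which are indexed from 1.\<close>

primrec cf_rem :: "real \<Rightarrow> nat \<Rightarrow> real" where
  "cf_rem x 0 = x"
| "cf_rem x (Suc n) = frac (1 / cf_rem x n)"

definition cf_digit :: "real \<Rightarrow> nat \<Rightarrow> nat" where
  "cf_digit x i = nat \<lfloor>1 / cf_rem x (i - 1)\<rfloor>"

lemma cf_rem_irrational:
  assumes "x \<notin> \<rat>" "0 < x" "x < 1"
  shows "cf_rem x n \<notin> \<rat>" "0 < cf_rem x n" "cf_rem x n < 1"
proof -
  have "cf_rem x n \<notin> \<rat> \<and> 0 < cf_rem x n \<and> cf_rem x n < 1"
  proof (induction n)
    case 0 show ?case using assms by simp
  next
    case (Suc n)
    have i: "1 / cf_rem x n \<notin> \<rat>"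
    proof
      assume "1 / cf_rem x n \<in> \<rat>"
      then have "inverse (1 / cf_rem x n) \<in> \<rat>" by (rule Rats_inverse)
      then show False using Suc by simp
    qed
    have f: "frac (1 / cf_rem x n) \<notin> \<rat>"
    proof
      assume "frac (1 / cf_rem x n) \<in> \<rat>"
      then have "frac (1 / cf_rem x n) + of_int \<lfloor>1 / cf_rem x n\<rfloor> \<in> \<rat>" by (intro Rats_add) auto
      then show False using i by (simp add: frac_def)
    qed
    then have "frac (1 / cf_rem x n) \<noteq> 0" by (metis Rats_0)
    then show ?case using f frac_ge_0[of "1 / cf_rem x n"] frac_lt_1[of "1 / cf_rem x n"] by simp
  qed
  then show "cf_rem x n \<notin> \<rat>" "0 < cf_rem x n" "cf_rem x n < 1" by auto
qed

lemma cf_digit_ge_1: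
  assumes "x \<notin> \<rat>" "0 < x" "x < 1"
  shows "cf_digit x i \<ge> 1"
proof -
  have "1 \<le> 1 / cf_rem x (i - 1)" using cf_rem_irrational(2,3)[OF assms, of "i - 1"]
    by (simp add: field_simps del: One_nat_def)
  then have "1 \<le> \<lfloor>1 / cf_rem x (i - 1)\<rfloor>" by (simp add: le_floor_iff)
  then show ?thesis unfolding cf_digit_def by linarith
qed

lemma cf_rem_unfold:
  assumes "x \<notin> \<rat>" "0 < x" "x < 1"
  shows "cf_rem x n = 1 / (real (cf_digit x (Suc n)) + cf_rem x (Suc n))"
proof -
  have "0 < cf_rem x n" using cf_rem_irrational[OF assms] by simp
  then have "real (cf_digit x (Suc n)) = of_int \<lfloor>1 / cf_rem x n\<rfloor>" by (simp add: cf_digit_def)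
  then show ?thesis by (simp add: frac_def)
qed

datatype turn = Turn_L | Turn_R

text \<open>The word \<open>L\<^bsup>a\<^sub>1\<^esup> R\<^bsup>a\<^sub>2\<^esup> L\<^bsup>a\<^sub>3\<^esup> \<dots>\<close> with \<open>m\<close> blocks. For irrational \<open>x\<close> every block is
  nonempty, so the letter of the infinite word at position \<open>j\<close> (counted from 0) is already
  contained in the first \<open>j + 1\<close> blocks.\<close>

definition path_prefix :: "real \<Rightarrow> nat \<Rightarrow> turn list" where
  "path_prefix x m =
     concat (map (\<lambda>i. replicate (cf_digit x i) (if odd i then Turn_L else Turn_R)) [1..<Suc m])"

definition path_letter :: "real \<Rightarrow> nat \<Rightarrow> turn" where
  "path_letter x j = path_prefix x (Suc j) ! j"

text \<open>The only child of \<open>1/1\<close> is \<open>1/2\<close> (see \<open>children_1\<close>) and it is reached by the first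
  letter, which is always L.\<close>

fun take_turn :: "turn \<Rightarrow> rat \<Rightarrow> rat" where
  "take_turn Turn_L r = Min (children r)"
| "take_turn Turn_R r = Max (children r)"

primrec path_node :: "real \<Rightarrow> nat \<Rightarrow> rat" where
  "path_node x 0 = 1"
| "path_node x (Suc j) = take_turn (path_letter x j) (path_node x j)"

definition haros_P :: "nat \<Rightarrow> real \<Rightarrow> real" where
  "haros_P k x =
     (if x \<in> \<rat> then degree_fraction k (haros_graph (THE r. of_rat r = x))
      else lim (\<lambda>j. degree_fraction k (haros_graph (path_node x j))))"

end

theory Submission
  imports Defs
begin

text \<open>
  Concatenation raises the degree of each end node by one and creates a single new inner node,
  whose degree is the sum of the two degrees being merged. For \<open>p/q < 1/2\<close> both parents lie in
  \<open>[0, 1/2]\<close>, and the degrees of the end nodes are large enough for a new inner node to have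
  degree 3 (when the left parent is \<open>0/1\<close>) or at least 5 (otherwise). Hence the numbers of
  inner nodes of degree 2, 3 and 4 are \<open>p\<close>, \<open>q - 2 p\<close> and 0 by additivity, while the boundary
  node has degree at least 5. For irrational \<open>x\<close>, the path always turns towards \<open>x\<close>, because the
  position of \<open>x\<close> between the two parents of the current node evolves by the subtractive
  continued fraction algorithm; hence the visited fractions converge to \<open>x\<close>.
\<close>

section \<open>Degrees in a concatenation\<close>

definition wf_graph :: "ograph \<Rightarrow> bool" where
  "wf_graph G \<longleftrightarrow> 2 \<le> num_nodes G \<and> (\<forall>e\<in>edges G. e \<subseteq> {1..num_nodes G} \<and> card e = 2)"

text \<open>Both end nodes are left out: they form the boundary node, and concatenation changes
  their degrees while the degrees of inner nodes stay fixed.\<close>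

definition inner_count :: "nat \<Rightarrow> ograph \<Rightarrow> nat" where
  "inner_count k G = card {v \<in> {2..<num_nodes G}. node_degree G v = k}"

lemma wf_graph_finite_edges: "wf_graph G \<Longrightarrow> finite (edges G)"
  by (rule finite_subset[of _ "Pow {1..num_nodes G}"]) (auto simp: wf_graph_def)

lemma wf_G0: "wf_graph G0"
  by (auto simp: wf_graph_def G0_def)

lemma num_nodes_concat [simp]:
  "num_nodes (G \<oplus>\<^sub>G H) = num_nodes G + num_nodes H - 1"
  by (simp add: concat_graph_def)

lemma wf_concat:
  assumes G: "wf_graph G" and H: "wf_graph H"
  shows "wf_graph (G \<oplus>\<^sub>G H)"
proof -
  let ?s = "\<lambda>j. num_nodes G - 1 + j"
  have "?s ` e \<subseteq> {1..num_nodes G + num_nodes H - 1} \<and> card (?s ` e) = 2" if "e \<in> edges H" for e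
  proof -
    have "e \<subseteq> {1..num_nodes H}" "card e = 2" using H that by (auto simp: wf_graph_def)
    moreover have "card (?s ` e) = card e" by (rule card_image) (auto simp: inj_on_def)
    moreover have "?s j \<in> {1..num_nodes G + num_nodes H - 1}" if "j \<in> {1..num_nodes H}" for j
      using G that by (auto simp: wf_graph_def)
    ultimately show ?thesis by (metis image_subsetI subsetD)
  qed
  moreover have "e \<subseteq> {1..num_nodes G + num_nodes H - 1} \<and> card e = 2" if "e \<in> edges G" for e
  proof -
    have "e \<subseteq> {1..num_nodes G}" "card e = 2" using G that by (auto simp: wf_graph_def)
    moreover have "{1..num_nodes G} \<subseteq> {1..num_nodes G + num_nodes H - 1}"
      using H by (auto simp: wf_graph_def)
    ultimately show ?thesis by blast
  qed
  moreover have "{1, num_nodes G + num_nodes H - 1} \<subseteq> {1..num_nodes G + num_nodes H - 1}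
      \<and> card {1, num_nodes G + num_nodes H - 1} = 2"
    using G H by (auto simp: wf_graph_def)
  moreover have "2 \<le> num_nodes G + num_nodes H - 1" using G H by (auto simp: wf_graph_def)
  ultimately show ?thesis
    unfolding wf_graph_def num_nodes_concat unfolding concat_graph_def by auto
qed

lemma node_degree_outside:
  assumes "wf_graph G" "v \<notin> {1..num_nodes G}"
  shows "node_degree G v = 0"
proof -
  have "{e \<in> edges G. v \<in> e} = {}" using assms unfolding wf_graph_def by blast
  then show ?thesis unfolding node_degree_def by (simp only: card.empty)
qed

text \<open>The edges at \<open>v\<close> come from three disjoint families: the edges of
  \<open>G\<close>, the shifted edges of \<open>H\<close> and the new edge. The shift sends node 1
  of \<open>H\<close> to the merging node \<open>num_nodes G\<close>.\<close>

lemma node_degree_concat: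
  assumes G: "wf_graph G" and H: "wf_graph H"
  shows "node_degree (G \<oplus>\<^sub>G H) v =
    node_degree G v + (if num_nodes G \<le> v then node_degree H (v - (num_nodes G - 1)) else 0) +
    (if v = 1 \<or> v = num_nodes G + num_nodes H - 1 then 1 else 0)"
proof -
  define a where "a = num_nodes G"
  define b where "b = num_nodes H"
  define s where "s = (\<lambda>j. a - 1 + j)"
  have ab: "2 \<le> a" "2 \<le> b" using G H by (auto simp: wf_graph_def a_def b_def)
  have eG: "e \<subseteq> {1..a}" "card e = 2" if "e \<in> edges G" for e
    using G that by (auto simp: wf_graph_def a_def)
  have eH: "e \<subseteq> {1..b}" if "e \<in> edges H" for e
    using H that by (auto simp: wf_graph_def b_def)
  define A where "A = {e \<in> edges G. v \<in> e}"
  define B where "B = {e \<in> (`) s ` edges H. v \<in> e}"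
  define C where "C = {e \<in> {{1, a + b - 1}}. v \<in> e}"
  have E: "{e \<in> edges (G \<oplus>\<^sub>G H). v \<in> e} = A \<union> B \<union> C"
    unfolding A_def B_def C_def concat_graph_def a_def b_def s_def by auto
  have sH: "s ` e \<subseteq> {a..a + b - 1}" if "e \<in> edges H" for e
    using eH[OF that] ab by (force simp: s_def)
  have fin: "finite A" "finite B" "finite C"
    using wf_graph_finite_edges[OF G] wf_graph_finite_edges[OF H]
    by (auto simp: A_def B_def C_def)
  \<comment> \<open>The ranges \<open>{1..a}\<close> and \<open>{a..a + b - 1}\<close> meet only in
    the merging node, which is too little for an edge with two ends.\<close>
  have "A \<inter> B = {}"
  proof -
    have False if "e \<in> edges G" "e' \<in> edges H" "e = s ` e'" for e e'
    proof -
      have "e \<subseteq> {a}" using eG(1)[OF that(1)] sH[OF that(2)] that(3) by force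
      then have "card e \<le> card {a}" by (intro card_mono) auto
      then show False using eG(2)[OF that(1)] by simp
    qed
    then show ?thesis by (auto simp: A_def B_def)
  qed
  \<comment> \<open>The new edge ends beyond every node of \<open>G\<close> and starts before every
    shifted node of \<open>H\<close>.\<close>
  moreover have "(A \<union> B) \<inter> C = {}"
  proof -
    have "{1, a + b - 1} \<notin> edges G" using eG(1)[of "{1, a + b - 1}"] ab by auto
    moreover have "{1, a + b - 1} \<notin> (`) s ` edges H"
    proof
      assume "{1, a + b - 1} \<in> (`) s ` edges H"
      then obtain e where "e \<in> edges H" "{1, a + b - 1} = s ` e" by auto
      then have "{1, a + b - 1} \<subseteq> {a..a + b - 1}" using sH by simp
      then show False using ab by auto
    qed
    ultimately show ?thesis by (auto simp: A_def B_def C_def)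
  qed
  ultimately have "card (A \<union> B \<union> C) = card A + card B + card C"
    using fin by (simp add: card_Un_disjoint)
  moreover have "card B = (if a \<le> v then node_degree H (v - (a - 1)) else 0)"
  proof (cases "a \<le> v")
    case True
    then have v: "v = s (v - (a - 1))" by (simp add: s_def)
    have "inj s" by (auto simp: s_def inj_on_def)
    then have "v \<in> s ` e \<longleftrightarrow> v - (a - 1) \<in> e" for e
      by (subst v) (simp add: inj_image_mem_iff)
    then have "B = (`) s ` {e \<in> edges H. v - (a - 1) \<in> e}"
      by (auto simp: B_def)
    moreover have "inj ((`) s)" using \<open>inj s\<close> by (simp add: inj_image_eq_iff inj_on_def)
    ultimately show ?thesis using True
      by (simp add: node_degree_def card_image inj_on_subset)
  next
    case False
    then have "B = {}" using sH by (force simp: B_def)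
    then show ?thesis using False by simp
  qed
  moreover have "card C = (if v = 1 \<or> v = a + b - 1 then 1 else 0)"
  proof -
    have "C = (if v = 1 \<or> v = a + b - 1 then {{1, a + b - 1}} else {})" by (auto simp: C_def)
    then show ?thesis by simp
  qed
  ultimately show ?thesis
    unfolding node_degree_def[of "G \<oplus>\<^sub>G H"] E by (simp add: A_def node_degree_def a_def b_def)
qed

lemma node_degree_concat_first:
  assumes "wf_graph G" "wf_graph H"
  shows "node_degree (G \<oplus>\<^sub>G H) 1 = node_degree G 1 + 1"
  using assms node_degree_concat[OF assms, of 1] by (simp add: wf_graph_def)

lemma node_degree_concat_last:
  assumes "wf_graph G" "wf_graph H"
  shows "node_degree (G \<oplus>\<^sub>G H) (num_nodes (G \<oplus>\<^sub>G H)) = node_degree H (num_nodes H) + 1"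
proof -
  have ab: "2 \<le> num_nodes G" "2 \<le> num_nodes H" using assms by (auto simp: wf_graph_def)
  then have "num_nodes G + num_nodes H - 1 - (num_nodes G - 1) = num_nodes H" by simp
  moreover have "node_degree G (num_nodes G + num_nodes H - 1) = 0"
    using ab by (intro node_degree_outside assms) auto
  ultimately show ?thesis
    using ab node_degree_concat[OF assms, of "num_nodes G + num_nodes H - 1"] by auto
qed

text \<open>Inner nodes of both graphs keep their degrees, and the merging node is the only node
  that becomes inner.\<close>

lemma inner_count_concat:
  assumes G: "wf_graph G" and H: "wf_graph H"
  shows "inner_count k (G \<oplus>\<^sub>G H) = inner_count k G + inner_count k H +
    (if node_degree G (num_nodes G) + node_degree H 1 = k then 1 else 0)"
proof -
  define a where "a = num_nodes G"
  define b where "b = num_nodes H"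
  let ?D = "node_degree (G \<oplus>\<^sub>G H)"
  have ab: "2 \<le> a" "2 \<le> b" using G H by (auto simp: wf_graph_def a_def b_def)
  have dG: "?D v = node_degree G v" if "v \<in> {2..<a}" for v
    using that ab node_degree_concat[OF G H, of v] by (auto simp: a_def b_def)
  have da: "?D a = node_degree G a + node_degree H 1"
    using ab node_degree_concat[OF G H, of a] by (auto simp: a_def b_def)
  have dH: "?D (a - 1 + j) = node_degree H j" if "j \<in> {2..<b}" for j
    using that ab node_degree_concat[OF G H, of "a - 1 + j"]
      node_degree_outside[OF G, of "a - 1 + j"] by (auto simp: a_def b_def)
  let ?A = "{v \<in> {2..<a}. node_degree G v = k}"
  let ?B = "(\<lambda>j. a - 1 + j) ` {j \<in> {2..<b}. node_degree H j = k}"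
  let ?C = "if ?D a = k then {a} else {}"
  have "{v \<in> {2..<a + b - 1}. ?D v = k} = ?A \<union> ?B \<union> ?C" (is "?L = ?R")
  proof (rule set_eqI)
    fix v
    \<comment> \<open>The value \<open>j = 1\<close> would be the merging node. No upper bound is
      put on \<open>j\<close>, so nodes past the last one fall under the fourth case.\<close>
    consider "v < 2" | "v \<in> {2..<a}" | "v = a" | j where "v = a - 1 + j" "2 \<le> j"
    proof -
      assume "v < 2 \<Longrightarrow> thesis" "v \<in> {2..<a} \<Longrightarrow> thesis" "v = a \<Longrightarrow> thesis"
        and 4: "\<And>j. v = a - 1 + j \<Longrightarrow> 2 \<le> j \<Longrightarrow> thesis"
      then show thesis using 4[of "v - (a - 1)"] ab by fastforce
    qed
    then show "v \<in> ?L \<longleftrightarrow> v \<in> ?R"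
    proof cases
      case 1
      then show ?thesis using ab by auto
    next
      case 2
      then show ?thesis using ab dG[OF 2] by auto
    next
      case 3
      then show ?thesis using ab by auto
    next
      case 4
      have "inj (\<lambda>j. a - 1 + j)" by (auto simp: inj_on_def)
      then have "v \<in> ?B \<longleftrightarrow> j < b \<and> node_degree H j = k"
        unfolding 4(1) by (subst inj_image_mem_iff) (use 4(2) in auto)
      moreover have "v \<in> ?L \<longleftrightarrow> j < b \<and> node_degree H j = k"
        using 4 ab dH[of j] by auto
      moreover have "v \<notin> ?A" "v \<notin> ?C" using 4 ab by auto
      ultimately show ?thesis by blast
    qed
  qed
  moreover have "card (?A \<union> ?B \<union> ?C) = card ?A + card ?B + card ?C"
  proof -
    have "?A \<inter> ?B = {}" "(?A \<union> ?B) \<inter> ?C = {}" by auto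
    then show ?thesis by (subst card_Un_disjoint; (subst card_Un_disjoint)?) auto
  qed
  moreover have "card ?B = card {j \<in> {2..<b}. node_degree H j = k}"
    by (rule card_image) (auto simp: inj_on_def)
  ultimately show ?thesis
    by (simp add: inner_count_def da flip: a_def b_def)
qed

text \<open>The boundary node is the only one that enters \<open>degree_fraction\<close> but not
  \<open>inner_count\<close>; the hypothesis says that its degree differs from
  \<open>k\<close>.\<close>

lemma degree_fraction_inner_count:
  assumes "node_degree G 1 + node_degree G (num_nodes G) \<noteq> k"
  shows "degree_fraction k G = real (inner_count k G) / real (num_nodes G - 1)"
proof -
  have "{v \<in> {1..<num_nodes G}. merged_degree G v = k}
      = {v \<in> {2..<num_nodes G}. node_degree G v = k}"
    using assms by (auto simp: merged_degree_def Suc_le_eq numeral_2_eq_2)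
  then show ?thesis by (simp add: degree_fraction_def inner_count_def)
qed

section \<open>Haros graphs below 1/2\<close>

lemma wf_haros_graph: "wf_graph (haros_graph r)"
proof (induction r rule: haros_graph.induct)
  case (1 r)
  then show ?case by (subst haros_graph.simps) (simp add: wf_G0 wf_concat)
qed

lemma is_parents_range:
  assumes "is_parents r a b"
  shows "0 < r" "r < 1" "0 \<le> a"
proof -
  obtain n where n: "n \<ge> 1" "adjacent_in (farey_upto n) a b" "r = mediant a b"
    using assms by (auto simp: is_parents_def)
  then have "r \<in> farey_level (Suc n)" by (auto simp: farey_level_Suc)
  then show "0 < r" "r < 1" using farey_level_between[of "Suc n" r] n(1) by auto
  obtain i where "i \<ge> 1" "a \<in> farey_level i"
    using n by (auto simp: adjacent_in_def farey_upto_def)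
  then show "0 \<le> a" using farey_level_between[of i a] by (cases "i = 1") auto
qed

lemma haros_graph_mediant:
  assumes "is_parents r a b"
  shows "haros_graph r = haros_graph a \<oplus>\<^sub>G haros_graph b"
  using is_parents_range[OF assms] parents_eqI[OF assms] by (subst haros_graph.simps) simp

lemma is_parents_half: "is_parents (1 / 2) 0 1"
  unfolding is_parents_def
  by (rule exI[of _ 1]) (simp add: farey_upto_1 adjacent_01 mediant_0_1)

lemma quotient_of_half: "quotient_of (1 / 2) = (1, 2)"
  using is_parents_sum[OF is_parents_half] by (simp add: prod_eq_iff)

text \<open>The denominator of a number between two parents is at least the sum of theirs, so
  \<open>1/2\<close> can only separate parents with denominator 1.\<close>

lemma right_parent_le_half:
  assumes "is_parents r a b" "r < 1 / 2"
  shows "b \<le> 1 / 2"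
proof (rule ccontr)
  assume b: "\<not> b \<le> 1 / 2"
  have u: "unimod a b" using is_parents_unimod assms by blast
  have "a < r" using mediant_between[OF u] assms(1) by (auto simp: is_parents_def)
  then have "den a + den b \<le> 2"
    using den_sum_le[OF u, of "1 / 2"] b assms by (simp add: quotient_of_half)
  then have d: "den a = 1" "den b = 1" using den_pos[of a] den_pos[of b] by linarith+
  have "num r = num a + num b" "den r = 2" using is_parents_sum[OF assms(1)] d by simp_all
  moreover have "num b = num a + 1" using u d by (simp add: unimod_def)
  \<comment> \<open>A number with denominator 2 strictly between 0 and 1/2 would need an integer
    numerator strictly between 0 and 1.\<close>
  ultimately have "2 * num r < 2" "num r > 0" "num r = 2 * num a + 1"
    using assms(2) is_parents_range(1)[OF assms(1)] rat_less_iff[of r "1 / 2"] rat_less_iff[of 0 r]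
    by (auto simp: quotient_of_half)
  then show False by linarith
qed

text \<open>For \<open>r < 1/2\<close> the merging node has degree 3 if the left parent is \<open>0\<close>, and degree
  at least \<open>3 + 2\<close> otherwise.\<close>

lemma haros_graph_degrees:
  assumes "0 < r" "r \<le> 1 / 2"
  shows "2 \<le> node_degree (haros_graph r) 1 \<and>
    (num r = 1 \<longrightarrow> node_degree (haros_graph r) 1 = 2) \<and>
    2 \<le> node_degree (haros_graph r) (num_nodes (haros_graph r)) \<and>
    (r < 1 / 2 \<longrightarrow> 3 \<le> node_degree (haros_graph r) (num_nodes (haros_graph r))) \<and>
    int (inner_count 2 (haros_graph r)) = num r \<and>
    int (inner_count 3 (haros_graph r)) = den r - 2 * num r \<and>
    inner_count 4 (haros_graph r) = 0"
  using assms
proof (induction r rule: haros_graph.induct)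
  case (1 r)
  let ?deg1 = "\<lambda>r. node_degree (haros_graph r) 1"
  let ?degn = "\<lambda>r. node_degree (haros_graph r) (num_nodes (haros_graph r))"
  let ?I = "\<lambda>k r. inner_count k (haros_graph r)"
  define a where "a = left_parent r"
  define b where "b = right_parent r"
  have r: "0 < r" "r < 1" using "1.prems" by auto
  have par: "is_parents r a b" unfolding a_def b_def using is_parents_parents[OF r] .
  note s = is_parents_sum[OF par]
  have G: "haros_graph r = haros_graph a \<oplus>\<^sub>G haros_graph b" using haros_graph_mediant[OF par] .
  have d1: "?deg1 r = ?deg1 a + 1" and dn: "?degn r = ?degn b + 1"
    and I: "?I k r = ?I k a + ?I k b + (if ?degn a + ?deg1 b = k then 1 else 0)" for k
    unfolding G using wf_haros_graph
    by (simp_all add: node_degree_concat_first node_degree_concat_last[unfolded num_nodes_concat]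
        inner_count_concat del: One_nat_def)
  have G0: "haros_graph 0 = G0" "haros_graph 1 = G0" by (simp_all add: haros_graph.simps)
  have "{e. e = {1, 2} \<and> (2::nat) \<in> e} = {{1, 2}}" "{e. e = {1, 2} \<and> (1::nat) \<in> e} = {{1, 2}}"
    by auto
  then have D0: "node_degree G0 1 = 1" "node_degree G0 2 = 1" "num_nodes G0 = 2"
    "inner_count k G0 = 0" for k
    by (simp_all add: G0_def node_degree_def inner_count_def)
  show ?case
  proof (cases "r = 1 / 2")
    case True
    \<comment> \<open>Two copies of \<open>G0\<close> are joined: both end degrees become 2, and the
      single inner node has degree 1 + 1 = 2.\<close>
    then have "a = 0" "b = 1" using is_parents_unique[OF par[unfolded True] is_parents_half] by simp_all
    then show ?thesis unfolding True
      using d1 dn I D0 True by (simp add: G0 quotient_of_half del: One_nat_def)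
  next
    case False
    then have r2: "r < 1 / 2" using "1.prems" by simp
    have u: "unimod a b" using is_parents_unimod[OF par] .
    have ab: "0 \<le> a" "a < r" "r < b" "b \<le> 1 / 2"
      using is_parents_range[OF par] mediant_between[OF u] par right_parent_le_half[OF par r2]
      by (auto simp: is_parents_def)
    have IHb: "2 \<le> ?deg1 b" "num b = 1 \<longrightarrow> ?deg1 b = 2" "2 \<le> ?degn b"
      "int (?I 2 b) = num b" "int (?I 3 b) = den b - 2 * num b" "?I 4 b = 0"
      using "1.IH"(2) r ab unfolding b_def by auto
    have pb: "0 < num b" using ab rat_less_iff[of 0 b] by simp
    show ?thesis
    proof (cases "a = 0")
      case True
      \<comment> \<open>Hence the first node of the right graph has degree exactly 2, and merging
        with the end of \<open>G0\<close> gives degree 1 + 2 = 3. This extra node of degree 3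
        accounts for \<open>den r = den b + 1\<close>, while \<open>num r = num b\<close>.\<close>
      then have "num b = 1" using u by (simp add: unimod_def)
      then show ?thesis using IHb d1 dn I D0 s True by (simp add: G0 del: One_nat_def)
    next
      case False
      then have "0 < a" "a < 1 / 2" using ab r2 by auto
      then have IHa: "2 \<le> ?deg1 a" "3 \<le> ?degn a"
        "int (?I 2 a) = num a" "int (?I 3 a) = den a - 2 * num a" "?I 4 a = 0"
        using "1.IH"(1) r unfolding a_def by auto
      \<comment> \<open>Both numerators are positive, so \<open>num r\<close> is at least 2 and the
        clause for \<open>num r = 1\<close> is vacuous. The counts for degrees 2, 3 and 4 simply
        add, as numerators and denominators do.\<close>
      have "0 < num a" using \<open>0 < a\<close> rat_less_iff[of 0 a] by simp
      then show ?thesis using IHa IHb d1 dn I s pb by auto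
    qed
  qed
qed

section \<open>Degree fractions at rational points\<close>

lemma of_rat_num_den: "of_rat r = (of_int (num r) / of_int (den r) :: real)"
  by (metis Fract_quotient_of den_pos less_irrefl of_rat_rat)

lemma degree_fraction_haros_graph:
  assumes "0 < r" "r < 1 / 2"
  shows "degree_fraction 2 (haros_graph r) = of_rat r"
    "degree_fraction 3 (haros_graph r) = 1 - 2 * of_rat r"
    "degree_fraction 4 (haros_graph r) = 0"
proof -
  let ?G = "haros_graph r"
  note deg = haros_graph_degrees[of r]
  have n: "real (num_nodes ?G - 1) = of_int (den r)"
    using num_nodes_haros_graph[of r] assms den_pos[of r] by (simp add: less_imp_le)
  \<comment> \<open>The boundary node has degree at least 2 + 3 = 5, so only inner nodes can have
    degree \<open>k\<close>.\<close>
  have *: "degree_fraction k ?G = real (inner_count k ?G) / of_int (den r)" if "k \<le> 4" for k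
    using degree_fraction_inner_count[of ?G k] deg assms that n by auto
  have c: "real (inner_count 2 ?G) = of_int (num r)"
    "real (inner_count 3 ?G) = of_int (den r - 2 * num r)"
    using deg assms by (metis of_int_of_nat_eq less_imp_le)+
  have pos: "of_int (den r) > (0::real)" by simp
  show "degree_fraction 2 ?G = of_rat r" using *[of 2] c by (simp add: of_rat_num_den)
  show "degree_fraction 3 ?G = 1 - 2 * of_rat r"
    using *[of 3] c(2) pos by (simp add: of_rat_num_den diff_divide_distrib)
  show "degree_fraction 4 ?G = 0" using *[of 4] deg assms by simp
qed

section \<open>Convergence of the symbolic path\<close>

lemma path_prefix_Suc:
  "path_prefix x (Suc m) =
    path_prefix x m @ replicate (cf_digit x (Suc m)) (if even m then Turn_L else Turn_R)"
  by (simp add: path_prefix_def)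

lemma length_path_prefix: "length (path_prefix x m) = (\<Sum>i=1..m. cf_digit x i)"
  by (induction m) (simp_all add: path_prefix_Suc, simp add: path_prefix_def)

lemma path_prefix_mono: "m \<le> n \<Longrightarrow> \<exists>w. path_prefix x n = path_prefix x m @ w"
proof (induction n rule: dec_induct)
  case (step n)
  then show ?case by (auto simp: path_prefix_Suc)
qed simp

lemma path_letter_block:
  assumes x: "x \<notin> \<rat>" "0 < x" "x < 1"
    and j: "j = (\<Sum>i=1..m. cf_digit x i) + t" and t: "t < cf_digit x (Suc m)"
  shows "path_letter x j = (if even m then Turn_L else Turn_R)"
proof -
  \<comment> \<open>Nonempty blocks give \<open>m\<close> \<le> \<open>j\<close>, so the
    \<open>Suc j\<close> blocks behind \<open>path_letter x j\<close> include block
    \<open>Suc m\<close>, where position \<open>j\<close> lies. Blocks count from 1, hence an even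
    \<open>m\<close> means an L block.\<close>
  have "(\<Sum>i=1..m. 1) \<le> (\<Sum>i=1..m. cf_digit x i)"
    by (intro sum_mono cf_digit_ge_1 x)
  then have "Suc m \<le> Suc j" using j by simp
  then obtain w where "path_prefix x (Suc j) = path_prefix x (Suc m) @ w"
    using path_prefix_mono by blast
  then show ?thesis
    using j t by (simp add: path_letter_def path_prefix_Suc nth_append length_path_prefix)
qed

text \<open>The children are the mediants with the two parents and lie on opposite sides of
  \<open>r\<close>, which decides \<open>Min\<close> and \<open>Max\<close>. A turn thus replaces
  one parent by the current node.\<close>

lemma take_turn_parents:
  assumes "is_parents r a b"
  shows "take_turn Turn_L r = mediant a r" "take_turn Turn_R r = mediant r b"
    "is_parents (mediant a r) a r" "is_parents (mediant r b) r b"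
proof -
  obtain n where n: "n \<ge> 1" "adjacent_in (farey_upto n) a b" "r = mediant a b"
    using assms by (auto simp: is_parents_def)
  have u: "unimod a r" "unimod r b" using unimod_mediant[OF is_parents_unimod[OF assms]] n by auto
  have "mediant a r < mediant r b"
    using mediant_between[OF u(1)] mediant_between[OF u(2)] by auto
  moreover have "children r = {mediant a r, mediant r b}"
    using children_eq is_parents_range[OF assms] parents_eqI[OF assms] by simp
  ultimately show "take_turn Turn_L r = mediant a r" "take_turn Turn_R r = mediant r b"
    by simp_all
  show "is_parents (mediant a r) a r" "is_parents (mediant r b) r b"
    using farey_adjacent_Suc[OF n(1,2)] n(1,3)
    by (auto simp: is_parents_def intro!: exI[of _ "Suc n"])
qed

text \<open>The ratio \<open>(den a * x - num a) / (num b - den b * x)\<close> locates \<open>x\<close> between the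
  parents \<open>a\<close> and \<open>b\<close> of the current node. A turn subtracts 1 from it or from its inverse,
  so blocks of equal turns run through the continued fraction algorithm.\<close>

definition path_state :: "real \<Rightarrow> nat \<Rightarrow> rat \<Rightarrow> rat \<Rightarrow> nat \<Rightarrow> nat \<Rightarrow> bool" where
  "path_state x j a b m t \<longleftrightarrow>
    is_parents (path_node x j) a b \<and> int j < den a + den b \<and>
    j = (\<Sum>i=1..m. cf_digit x i) + t \<and> t < cf_digit x (Suc m) \<and>
    0 < of_int (den a) * x - of_int (num a) \<and> 0 < of_int (num b) - of_int (den b) * x \<and>
    (if even m
     then of_int (num b) - of_int (den b) * x =
       (1 / cf_rem x m - real t) * (of_int (den a) * x - of_int (num a))
     else of_int (den a) * x - of_int (num a) =
       (1 / cf_rem x m - real t) * (of_int (num b) - of_int (den b) * x))"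

text \<open>With \<open>u\<close>, \<open>v\<close> the offsets of \<open>x\<close> from the
  parents, a left turn turns \<open>(u, v)\<close> into \<open>(u, v - u)\<close> and a right turn
  into \<open>(u - v, v)\<close>, so the ratio \<open>z\<close> drops by 1. It exceeds 1 before each
  turn, being the number of letters left in the block plus a positive remainder.\<close>

lemma path_state_Suc:
  assumes x: "x \<notin> \<rat>" "0 < x" "x < 1" and st: "path_state x j a b m t"
  shows "\<exists>a b m t. path_state x (Suc j) a b m t"
proof -
  define r where "r = path_node x j"
  define u where "u = of_int (den a) * x - of_int (num a)"
  define v where "v = of_int (num b) - of_int (den b) * x"
  define z where "z = 1 / cf_rem x m - real t"
  have par: "is_parents r a b" and den: "int j < den a + den b"
    and j: "j = (\<Sum>i=1..m. cf_digit x i) + t" and t: "t < cf_digit x (Suc m)"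
    and uv: "0 < u" "0 < v" and rel: "if even m then v = z * u else u = z * v"
    using st unfolding path_state_def r_def u_def v_def z_def by blast+
  note s = is_parents_sum[OF par]
  note turn = take_turn_parents[OF par]
  have z: "z = real (cf_digit x (Suc m)) - real t + cf_rem x (Suc m)"
    unfolding z_def by (subst cf_rem_unfold[OF x, of m]) simp
  have rem: "0 < cf_rem x (Suc m)" using cf_rem_irrational[OF x] by blast
  then have z1: "1 < z" using z t by linarith
  have node: "path_node x (Suc j) = (if even m then mediant a r else mediant r b)"
    using path_letter_block[OF x j t] turn by (simp add: r_def)
  have den': "int (Suc j) < den a + den r" "int (Suc j) < den r + den b"
    using s den den_pos[of a] den_pos[of b] by linarith+
  have L: "of_int (num r) - of_int (den r) * x = v - u"
    and R: "of_int (den r) * x - of_int (num r) = u - v"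
    using s by (simp_all add: u_def v_def algebra_simps)
  \<comment> \<open>This puts \<open>x\<close> on the side of \<open>r\<close> chosen by the turn,
    so the new offsets are again positive.\<close>
  have less: "if even m then u < v else v < u"
    using rel z1 uv mult_strict_right_mono[OF z1, of u] mult_strict_right_mono[OF z1, of v]
    by (auto split: if_splits)
  show ?thesis
  proof (cases "Suc t < cf_digit x (Suc m)")
    case True
    show ?thesis
    proof (cases "even m")
      case e: True
      have "path_state x (Suc j) a r m (Suc t)"
        unfolding path_state_def L u_def[symmetric]
        using e True node turn den' j uv rel less by (simp add: z_def algebra_simps)
      then show ?thesis by blast
    next
      case e: False
      have "path_state x (Suc j) r b m (Suc t)"
        unfolding path_state_def R v_def[symmetric]
        using e True node turn den' j uv rel less by (simp add: z_def algebra_simps)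
      then show ?thesis by blast
    qed
  next
    case False
    then have d: "cf_digit x (Suc m) = Suc t" using t by simp
    \<comment> \<open>The block ends: \<open>z - 1\<close> is the next remainder, below 1, so the
      ratio is inverted and the next block starts with the other letter and
      \<open>t = 0\<close>.\<close>
    then have z: "z = 1 + cf_rem x (Suc m)" using z by simp
    have j': "Suc j = (\<Sum>i=1..Suc m. cf_digit x i) + 0" using j d by simp
    have d': "0 < cf_digit x (Suc (Suc m))" using cf_digit_ge_1[OF x, of "Suc (Suc m)"] by simp
    show ?thesis
    proof (cases "even m")
      case e: True
      have "v - u = cf_rem x (Suc m) * u" using rel e z by (simp add: algebra_simps)
      then have "u = (1 / cf_rem x (Suc m) - real 0) * (v - u)" using rem by simp
      then have "path_state x (Suc j) a r (Suc m) 0"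
        unfolding path_state_def L u_def[symmetric]
        using e node turn den' j' d' uv less by simp
      then show ?thesis by blast
    next
      case e: False
      have "u - v = cf_rem x (Suc m) * v" using rel e z by (simp add: algebra_simps)
      then have "v = (1 / cf_rem x (Suc m) - real 0) * (u - v)" using rem by simp
      then have "path_state x (Suc j) r b (Suc m) 0"
        unfolding path_state_def R v_def[symmetric]
        using e node turn den' j' d' uv less by simp
      then show ?thesis by blast
    qed
  qed
qed

text \<open>The invariant starts at \<open>j = 1\<close>, since the node 1/1 at \<open>j = 0\<close>
  has no parents.\<close>

lemma path_state_exists:
  assumes x: "x \<notin> \<rat>" "0 < x" "x < 1 / 2" and j: "1 \<le> j"
  shows "\<exists>a b m t. path_state x j a b m t"
  using j
proof (induction j rule: nat_induct_at_least)
  case base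
  have x1: "x < 1" using x by simp
  \<comment> \<open>Since \<open>x < 1 / 2\<close>, the first digit is at least 2, so one L leaves
    the walk inside the first block with \<open>m = 0\<close>, \<open>t = 1\<close> and parents 0
    and 1.\<close>
  have "2 \<le> 1 / x" using x by (simp add: field_simps)
  then have "2 \<le> \<lfloor>1 / x\<rfloor>" by (simp add: le_floor_iff)
  then have d: "1 < cf_digit x (Suc 0)" by (simp add: cf_digit_def)
  have "path_letter x 0 = Turn_L" using path_letter_block[OF x(1,2) x1, of 0 0 0] d by simp
  then have "path_node x 1 = 1 / 2" by (simp add: children_1)
  then have "path_state x 1 0 1 0 1"
    using is_parents_half d x x1
    unfolding path_state_def \<open>path_node x 1 = 1 / 2\<close> by (simp add: left_diff_distrib)
  then show ?case by blast
next
  case (Suc j)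
  then show ?case using path_state_Suc x by fastforce
qed

text \<open>The node and \<open>x\<close> both lie strictly between the parents, whose distance is
  the reciprocal of the product of their denominators.\<close>

lemma path_state_bounds:
  assumes "path_state x j a b m t"
  shows "0 < path_node x j" "\<bar>of_rat (path_node x j) - x\<bar> < 1 / real j"
proof -
  let ?r = "path_node x j"
  have par: "is_parents ?r a b" and den: "int j < den a + den b"
    and uv: "0 < of_int (den a) * x - of_int (num a)" "0 < of_int (num b) - of_int (den b) * x"
    using assms unfolding path_state_def by blast+
  show "0 < ?r" using is_parents_range[OF par] by simp
  have u: "unimod a b" using is_parents_unimod[OF par] .
  have "a < ?r" "?r < b" using mediant_between[OF u] par by (auto simp: is_parents_def)
  then have r: "of_rat a < (of_rat ?r :: real)" "of_rat ?r < (of_rat b :: real)"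
    by (simp_all add: of_rat_less)
  have pos: "0 < (of_int (den a) :: real)" "0 < (of_int (den b) :: real)" by simp_all
  have x: "of_rat a < x" "x < of_rat b"
    using uv pos unfolding of_rat_num_den by (simp_all add: field_simps)
  have "of_int (num b * den a - num a * den b) = (1 :: real)" using u by (simp add: unimod_def)
  then have gap: "of_rat b - of_rat a = (1 / of_int (den a * den b) :: real)"
    using den_pos[of a] den_pos[of b] unfolding of_rat_num_den
    by (simp add: field_simps del: den_pos)
  \<comment> \<open>Expanding gives product \<ge> sum - 1, and the sum of the denominators exceeds
    \<open>j\<close>.\<close>
  have "0 \<le> (den a - 1) * (den b - 1)"
    using den_pos[of a] den_pos[of b] by (intro mult_nonneg_nonneg) linarith+
  then have le: "int j \<le> den a * den b" using den by (simp add: algebra_simps)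
  show "\<bar>of_rat ?r - x\<bar> < 1 / real j"
  proof (cases "j = 0")
    \<comment> \<open>This case is contradictory: the node would be 1, which is not a mediant of
      parents.\<close>
    case True
    then have "?r = 1" by simp
    then show ?thesis using is_parents_range[OF par] by simp
  next
    case False
    have "\<bar>of_rat ?r - x\<bar> < of_rat b - of_rat a" using r x by linarith
    also have "\<dots> \<le> 1 / real j"
      unfolding gap
    proof (rule divide_left_mono)
      show "real j \<le> of_int (den a * den b)" using le by (metis of_int_le_iff of_int_of_nat_eq)
      show "0 < of_int (den a * den b) * real j" using pos False by simp
    qed simp
    finally show ?thesis .
  qed
qed

lemma path_node_pos:
  assumes "x \<notin> \<rat>" "0 < x" "x < 1 / 2"
  shows "0 < path_node x j"
  using path_state_exists[OF assms, of j] path_state_bounds(1) by (cases j) fastforce+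

lemma path_node_tendsto:
  assumes "x \<notin> \<rat>" "0 < x" "x < 1 / 2"
  shows "(\<lambda>j. of_rat (path_node x j)) \<longlonglongrightarrow> x"
proof -
  have "eventually (\<lambda>j. norm (of_rat (path_node x j) - x) \<le> 1 / real j) sequentially"
    using eventually_ge_at_top[of 1]
  proof eventually_elim
    case (elim j)
    then show ?case using path_state_exists[OF assms] path_state_bounds(2)
      by (metis real_norm_def less_imp_le)
  qed
  then have "(\<lambda>j. of_rat (path_node x j) - x) \<longlonglongrightarrow> 0"
    by (intro tendsto_0_le[OF lim_1_over_n[where 'a = real], where K = 1]) simp
  then show ?thesis by (simp add: LIM_zero_iff)
qed

section \<open>Rational values and passage to the limit\<close>

theorem theorem1:
  fixes x :: real
  assumes "0 < x" and "x < 1 / 2"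
  shows "(x \<notin> \<rat> \<longrightarrow>
            (\<forall>k\<in>{2, 3, 4}. convergent (\<lambda>j. degree_fraction k (haros_graph (path_node x j))))) \<and>
         haros_P 2 x = x \<and> haros_P 3 x = 1 - 2 * x \<and> haros_P 4 x = 0"
proof (cases "x \<in> \<rat>")
  case True
  then obtain r where r: "x = of_rat r" by (auto simp: Rats_def)
  have "(of_rat 0 :: real) < of_rat r" "(of_rat r :: real) < of_rat (1 / 2)"
    using assms r by (simp_all add: of_rat_divide)
  then have "0 < r" "r < 1 / 2" by (simp_all only: of_rat_less)
  then show ?thesis
    using True degree_fraction_haros_graph[of r] by (simp add: haros_P_def r)
next
  case False
  let ?P = "\<lambda>k j. degree_fraction k (haros_graph (path_node x j))"
  note lim = path_node_tendsto[OF False assms]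
  \<comment> \<open>The degree formulas hold only strictly below 1/2, while the path starts at 1 and
    1/2; convergence to \<open>x < 1 / 2\<close> makes them valid from some index on.\<close>
  have "eventually (\<lambda>j. of_rat (path_node x j) < (1 / 2 :: real)) sequentially"
    using order_tendstoD(2)[OF lim assms(2)] .
  then have ev: "eventually (\<lambda>j. 0 < path_node x j \<and> path_node x j < 1 / 2) sequentially"
  proof eventually_elim
    case (elim j)
    then have "(of_rat (path_node x j) :: real) < of_rat (1 / 2)" by (simp add: of_rat_divide)
    then show ?case using path_node_pos[OF False assms] by (simp only: of_rat_less)
  qed
  have "?P 2 \<longlonglongrightarrow> x"
    by (rule Lim_transform_eventually[OF lim])
      (use ev in eventually_elim, simp add: degree_fraction_haros_graph)
  moreover have "?P 3 \<longlonglongrightarrow> 1 - 2 * x"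
    by (rule Lim_transform_eventually[where f = "\<lambda>j. 1 - 2 * of_rat (path_node x j)"])
      (intro tendsto_intros lim, use ev in eventually_elim, simp add: degree_fraction_haros_graph)
  moreover have "?P 4 \<longlonglongrightarrow> 0"
    by (rule Lim_transform_eventually[OF tendsto_const])
      (use ev in eventually_elim, simp add: degree_fraction_haros_graph)
  ultimately show ?thesis
    using False by (auto simp: haros_P_def limI convergentI)
qed

end
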